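(* Let $a>0$, $\rho>0$, $0<\alpha<1$, $0\le\beta\le 1$, $\gamma=\alpha+\beta-\alpha\beta$, $x_a\in\mathbb{R}$, and let $\mu\in\mathbb{R}$ and $m$ satisfy $\mu>-\alpha$ and $1<m<\frac{1+\mu}{1-\alpha}$. If $x_a>0$, then the problem $$\begin{cases} {}^{\rho}D_{a+}^{\alpha,\beta}x(t)\ \ge\ \left(\frac{t^\rho-a^\rho}{\rho}\right)^{\mu}|x(t)|^{m}, & t>a,\\[1mm] {}^{\rho}I_{a+}^{1-\gamma}x(t)\big|_{t=a}=x_a, \end{cases}$$ has no global non-trivial solution in $C_{1-\gamma,\rho}^{\gamma}[a,b]$; that is, there is no function $x:(a,\infty)\to\mathbb{R}$, not identically zero, whose restriction to $(a,b]$ belongs to $C_{1-\gamma,\rho}^{\gamma}[a,b]$ for every $b>a$, which satisfies the inequality for all $t>a$ and the initial condition.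
   Context: Let $\rho>0$ and $a>0$. For $\sigma>0$ the left-sided Katugampola fractional integral is $${}^{\rho}I_{a+}^{\sigma}h(t)=\frac{1}{\Gamma(\sigma)}\int_a^t s^{\rho-1}\left(\frac{t^\rho-s^\rho}{\rho}\right)^{\sigma-1}h(s)\,ds,\qquad t>a,$$ and ${}^{\rho}I_{a+}^{0}$ is the identity. Put $\delta_\rho=t^{1-\rho}\frac{d}{dt}$. For $0<\alpha<1$, $0\le\beta\le1$, the (left-sided) generalized Katugampola fractional derivative of order $\alpha$ and type $\beta$ is $${}^{\rho}D_{a+}^{\alpha,\beta}h={}^{\rho}I_{a+}^{\beta(1-\alpha)}\,\delta_\rho\,{}^{\rho}I_{a+}^{(1-\beta)(1-\alpha)}h,$$ for functions $h$ for which the right-hand side exists. With $\gamma=\alpha+\beta-\alpha\beta$ one has $(1-\beta)(1-\alpha)=1-\gamma$. Write ${}^{\rho}D_{a+}^{\gamma}h=\delta_\rho\,{}^{\rho}I_{a+}^{1-\gamma}h$. For $0\le\nu<1$ and $b>a$, $C_{\nu,\rho}[a,b]$ is the space of functions $g:(a,b]\to\mathbb{R}$ such that $\left(\frac{t^\rho-a^\rho}{\rho}\right)^{\nu}g(t)$ belongs to $C[a,b]$ (i.e. is continuous on $(a,b]$ and extends continuously to $[a,b]$). The space $C_{1-\gamma,\rho}^{\gamma}[a,b]$ is $$C_{1-\gamma,\rho}^{\gamma}[a,b]=\{g\in C_{1-\gamma,\rho}[a,b]:\ {}^{\rho}D_{a+}^{\gamma}g\in C_{1-\gamma,\rho}[a,b]\}.$$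 The initial condition ${}^{\rho}I_{a+}^{1-\gamma}x(t)|_{t=a}=x_a$ means $\lim_{t\to a+}{}^{\rho}I_{a+}^{1-\gamma}x(t)=x_a$. *)

theory Defs
  imports "HOL-Analysis.Analysis"
begin

text \<open>
  Functions on \<open>(a,b]\<close> or \<open>(a,\<infinity>)\<close> are represented by total functions on the reals. None of the
  notions below looks at their values outside that domain.
\<close>

definition katugampola_kernel :: "real \<Rightarrow> real \<Rightarrow> real \<Rightarrow> real \<Rightarrow> real" where
  "katugampola_kernel \<rho> \<sigma> t s = s powr (\<rho> - 1) * ((t powr \<rho> - s powr \<rho>) / \<rho>) powr (\<sigma> - 1)"

definition katugampola_integral_exists ::
    "real \<Rightarrow> real \<Rightarrow> real \<Rightarrow> (real \<Rightarrow> real) \<Rightarrow> real \<Rightarrow> bool" where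
  "katugampola_integral_exists \<rho> a \<sigma> h t \<longleftrightarrow>
     \<sigma> = 0 \<or> set_integrable lborel {a<..<t} (\<lambda>s. katugampola_kernel \<rho> \<sigma> t s * h s)"

text \<open>The value is meaningful where \<^const>\<open>katugampola_integral_exists\<close> holds.\<close>

definition katugampola_integral ::
    "real \<Rightarrow> real \<Rightarrow> real \<Rightarrow> (real \<Rightarrow> real) \<Rightarrow> real \<Rightarrow> real" where
  "katugampola_integral \<rho> a \<sigma> h t =
     (if \<sigma> = 0 then h t
      else 1 / Gamma \<sigma> * (LINT s:{a<..<t}|lborel. katugampola_kernel \<rho> \<sigma> t s * h s))"

text \<open>
  The set \<open>S\<close> is the domain on which the function is considered, \<open>(a,b]\<close> or \<open>(a,\<infinity>)\<close>: at the
  endpoint \<open>b\<close> the derivative is the one-sided one, everywhere else it is the ordinary one.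
\<close>

definition delta_op :: "real \<Rightarrow> real set \<Rightarrow> (real \<Rightarrow> real) \<Rightarrow> real \<Rightarrow> real" where
  "delta_op \<rho> S f t = t powr (1 - \<rho>) * vector_derivative f (at t within S)"

definition katugampola_deriv ::
    "real \<Rightarrow> real \<Rightarrow> real set \<Rightarrow> real \<Rightarrow> (real \<Rightarrow> real) \<Rightarrow> real \<Rightarrow> real" where
  "katugampola_deriv \<rho> a S \<gamma> h = delta_op \<rho> S (katugampola_integral \<rho> a (1 - \<gamma>) h)"

definition katugampola_deriv_exists_on ::
    "real \<Rightarrow> real \<Rightarrow> real set \<Rightarrow> real \<Rightarrow> (real \<Rightarrow> real) \<Rightarrow> bool" where
  "katugampola_deriv_exists_on \<rho> a S \<gamma> h \<longleftrightarrow>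
     (\<forall>t\<in>S. katugampola_integral_exists \<rho> a (1 - \<gamma>) h t \<and>
            katugampola_integral \<rho> a (1 - \<gamma>) h differentiable (at t within S))"

definition gen_katugampola_deriv ::
    "real \<Rightarrow> real \<Rightarrow> real set \<Rightarrow> real \<Rightarrow> real \<Rightarrow> (real \<Rightarrow> real) \<Rightarrow> real \<Rightarrow> real" where
  "gen_katugampola_deriv \<rho> a S \<alpha> \<beta> h =
     katugampola_integral \<rho> a (\<beta> * (1 - \<alpha>))
       (delta_op \<rho> S (katugampola_integral \<rho> a ((1 - \<beta>) * (1 - \<alpha>)) h))"

definition gen_katugampola_deriv_exists_on ::
    "real \<Rightarrow> real \<Rightarrow> real set \<Rightarrow> real \<Rightarrow> real \<Rightarrow> (real \<Rightarrow> real) \<Rightarrow> bool" where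
  "gen_katugampola_deriv_exists_on \<rho> a S \<alpha> \<beta> h \<longleftrightarrow>
     (\<forall>t\<in>S. katugampola_integral_exists \<rho> a ((1 - \<beta>) * (1 - \<alpha>)) h t \<and>
            katugampola_integral \<rho> a ((1 - \<beta>) * (1 - \<alpha>)) h differentiable (at t within S) \<and>
            katugampola_integral_exists \<rho> a (\<beta> * (1 - \<alpha>))
              (delta_op \<rho> S (katugampola_integral \<rho> a ((1 - \<beta>) * (1 - \<alpha>)) h)) t)"

definition weighted_C :: "real \<Rightarrow> real \<Rightarrow> real \<Rightarrow> real \<Rightarrow> (real \<Rightarrow> real) set" where
  "weighted_C \<nu> \<rho> a b =
     {g. \<exists>f. continuous_on {a..b} f \<and>
             (\<forall>t\<in>{a<..b}. f t = ((t powr \<rho> - a powr \<rho>) / \<rho>) powr \<nu> * g t)}"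

text \<open>The space \<open>C\<^sup>\<gamma>\<^bsub>1-\<gamma>,\<rho>\<^esub>[a,b]\<close>.\<close>

definition weighted_C_gamma :: "real \<Rightarrow> real \<Rightarrow> real \<Rightarrow> real \<Rightarrow> (real \<Rightarrow> real) set" where
  "weighted_C_gamma \<gamma> \<rho> a b =
     {g \<in> weighted_C (1 - \<gamma>) \<rho> a b.
        katugampola_deriv_exists_on \<rho> a {a<..b} \<gamma> g \<and>
        katugampola_deriv \<rho> a {a<..b} \<gamma> g \<in> weighted_C (1 - \<gamma>) \<rho> a b}"

definition global_solution ::
    "real \<Rightarrow> real \<Rightarrow> real \<Rightarrow> real \<Rightarrow> real \<Rightarrow> real \<Rightarrow> real \<Rightarrow> (real \<Rightarrow> real) \<Rightarrow> bool" where
  "global_solution \<rho> a \<alpha> \<beta> \<mu> m xa x \<longleftrightarrow>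
     (let \<gamma> = \<alpha> + \<beta> - \<alpha> * \<beta> in
       (\<forall>b>a. x \<in> weighted_C_gamma \<gamma> \<rho> a b) \<and>
       gen_katugampola_deriv_exists_on \<rho> a {a<..} \<alpha> \<beta> x \<and>
       (\<forall>t>a. gen_katugampola_deriv \<rho> a {a<..} \<alpha> \<beta> x t
                \<ge> ((t powr \<rho> - a powr \<rho>) / \<rho>) powr \<mu> * \<bar>x t\<bar> powr m) \<and>
       (katugampola_integral \<rho> a (1 - \<gamma>) x \<longlongrightarrow> xa) (at_right a))"

end

theory Submission
  imports Defs
begin

text \<open>
  Write \<open>\<tau> = (t\<^sup>\<rho> - a\<^sup>\<rho>) / \<rho>\<close>, \<open>f = D\<^sup>\<gamma> x\<close> and \<open>g = D\<^sup>\<alpha>\<^sup>,\<^sup>\<beta> x = I\<^sup>\<gamma>\<^sup>-\<^sup>\<alpha> f\<close>. The fundamental theorem of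
  calculus gives \<open>I\<^sup>1\<^sup>-\<^sup>\<gamma> x = xa + I\<^sup>1 f\<close>; applying \<open>I\<^sup>\<gamma>\<close> and the semigroup law of the fractional
  integrals (Tonelli and the Beta integral) yields \<open>I\<^sup>1 x = K \<tau>\<^sup>\<gamma> + I\<^sup>1 (I\<^sup>\<alpha> g)\<close> with \<open>K \<ge> 0\<close>, hence
  \<open>x \<ge> I\<^sup>\<alpha> g\<close>. No test function is needed after that: the kernel of \<open>I\<^sup>\<alpha>\<close> is at least
  \<open>\<tau>\<^sup>\<alpha>\<^sup>-\<^sup>1 / \<Gamma>(\<alpha>)\<close>, so \<open>F = I\<^sup>1 (\<tau>\<^sup>\<mu> |x|\<^sup>m)\<close> satisfies \<open>x \<ge> c \<tau>\<^sup>\<alpha>\<^sup>-\<^sup>1 F\<close> and therefore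
  \<open>dF/d\<tau> \<ge> c\<^sup>m \<tau>\<^sup>\<theta> F\<^sup>m\<close> with \<open>\<theta> = \<mu> - m (1 - \<alpha>)\<close>. The hypothesis on \<open>m\<close> says exactly \<open>\<theta> > -1\<close>, so
  \<open>\<tau>\<^sup>\<theta>\<close> is not integrable at infinity and \<open>F\<close>, once positive, blows up in finite time.
\<close>

section \<open>Gaps of the power function and the Beta integral\<close>

text \<open>In this variable Katugampola integrals become Riemann-Liouville integrals. Both
  endpoints are arguments because gaps from \<open>a\<close> and gaps up to \<open>t\<close> occur
  together, tied by \<open>rpow_gap \<rho> s t = rpow_gap \<rho> s r + rpow_gap \<rho> r
  t\<close>.\<close>

abbreviation rpow_gap :: "real \<Rightarrow> real \<Rightarrow> real \<Rightarrow> real" where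
  "rpow_gap \<rho> s t \<equiv> (t powr \<rho> - s powr \<rho>) / \<rho>"

lemma rpow_gap_pos: "0 < \<rho> \<Longrightarrow> 0 \<le> s \<Longrightarrow> s < t \<Longrightarrow> 0 < rpow_gap \<rho> s t"
  by (simp add: powr_less_mono2)

lemma rpow_gap_deriv:
  assumes "0 < \<rho>" "0 < t"
  shows "(rpow_gap \<rho> s has_real_derivative t powr (\<rho> - 1)) (at t within S)"
  using assms by (auto intro!: derivative_eq_intros)

lemma katugampola_kernel_nonneg: "0 \<le> katugampola_kernel \<rho> \<sigma> t s"
  by (simp add: katugampola_kernel_def)

lemma katugampola_kernel_measurable [measurable]:
  "case_prod (katugampola_kernel \<rho> \<sigma>) \<in> borel_measurable (borel \<Otimes>\<^sub>M borel)"
  unfolding katugampola_kernel_def by measurable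

text \<open>The substitution \<open>u = rpow_gap \<rho> s r / rpow_gap \<rho> s t\<close> maps the
  interval onto the unit interval, and additivity of the gap makes \<open>1 - u\<close> the matching
  quotient for \<open>rpow_gap \<rho> r t\<close>. What remains is Euler's Beta integrand.\<close>

lemma katugampola_kernel_beta:
  assumes "0 < \<rho>" "0 < s" "s < t" "0 < p" "0 < q"
  shows "set_integrable lborel {s<..<t} (\<lambda>r. katugampola_kernel \<rho> p t r * rpow_gap \<rho> s r powr (q - 1))" (is ?I)
    and "(LINT r:{s<..<t}|lborel. katugampola_kernel \<rho> p t r * rpow_gap \<rho> s r powr (q - 1))
           = Beta p q * rpow_gap \<rho> s t powr (p + q - 1)" (is ?E)
proof -
  define D where "D = rpow_gap \<rho> s t"
  have D: "D > 0" using rpow_gap_pos[of \<rho> s t] assms by (simp add: D_def)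
  define g where "g r = rpow_gap \<rho> s r / D" for r
  define g' where "g' r = r powr (\<rho> - 1) / D" for r
  \<comment> \<open>The exponent of \<open>q\<close> sits on \<open>u\<close> and that of
    \<open>p\<close> on \<open>1 - u\<close>, so \<open>Beta q p\<close> appears until
    \<open>Beta_commute\<close> at the end.\<close>
  define B where "B u = u powr (q - 1) * (1 - u) powr (p - 1)" for u :: real
  have der: "(g has_field_derivative g' r) (at r within A)" if "r > 0" for r A
    unfolding g_def g'_def using rpow_gap_deriv[of \<rho> r s A] assms that DERIV_cdivide by blast
  have gmono: "g r < g r'" if "s \<le> r" "r < r'" for r r'
    using that assms D by (simp add: g_def divide_strict_right_mono powr_less_mono2)
  have inj: "inj_on g {s<..<t}"
    by (rule inj_onI) (metis gmono greaterThanLessThan_iff less_le_not_le linorder_less_linear order.strict_implies_order)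
  have gs: "g s = 0" "g t = 1" using D by (simp add: g_def, simp add: g_def flip: D_def)
  have cont: "continuous_on {s..t} g"
    using der assms by (intro DERIV_continuous_on[of _ _ g']) auto
  have img: "g ` {s<..<t} = {0<..<1}"
  proof
    show "g ` {s<..<t} \<subseteq> {0<..<1}"
      using gmono[of s] gmono[of _ t] gs by fastforce
    show "{0<..<1} \<subseteq> g ` {s<..<t}"
    proof
      fix u :: real assume u: "u \<in> {0<..<1}"
      obtain r where "s \<le> r" "r \<le> t" "g r = u"
        using IVT'[of g s u t] u gs cont assms by auto
      then show "u \<in> g ` {s<..<t}" using u gs by (intro image_eqI[of _ _ r]) (auto simp: less_le)
    qed
  qed
  have "(B has_integral Beta q p) {0<..<1}"
    using has_integral_Beta_real[of q p] assms by (simp add: has_integral_Icc_iff_Ioo B_def[abs_def])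
  then have "B absolutely_integrable_on {0<..<1} \<and> integral {0<..<1} B = Beta q p"
    by (auto simp: has_integral_iff B_def intro!: nonnegative_absolutely_integrable_1)
  then have 1: "(\<lambda>r. \<bar>g' r\<bar> * B (g r)) absolutely_integrable_on {s<..<t}"
       and 2: "integral {s<..<t} (\<lambda>r. \<bar>g' r\<bar> * B (g r)) = Beta q p"
    using has_absolute_integral_change_of_variables_1'[OF _ _ inj, of g' B "Beta q p"] der assms
    unfolding img by auto
  have hi: "((\<lambda>r. \<bar>g' r\<bar> * B (g r)) has_integral Beta q p) {s<..<t}"
    using 1 2 set_lebesgue_integral_eq_integral(1) by (auto simp: has_integral_iff)
  \<comment> \<open>The power of \<open>D\<close> collects one factor from \<open>g'\<close> and the
    factors \<open>D powr (q - 1)\<close> and \<open>D powr (p - 1)\<close> from normalising both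
    gaps.\<close>
  have eq: "\<bar>g' r\<bar> * B (g r) * D powr (p + q - 1) = katugampola_kernel \<rho> p t r * rpow_gap \<rho> s r powr (q - 1)"
    if r: "r \<in> {s<..<t}" for r
  proof -
    define U V where "U = rpow_gap \<rho> r t" and "V = rpow_gap \<rho> s r"
    have pos: "U > 0" "V > 0"
      using r assms by (auto simp: U_def V_def intro!: rpow_gap_pos)
    have "D = U + V" by (simp add: D_def U_def V_def diff_divide_distrib)
    then have gr: "g r = V / D" "1 - g r = U / D"
      using D by (simp_all add: g_def V_def[symmetric] field_simps)
    have "D powr (p + q - 1) = D * (D powr (q - 1) * D powr (p - 1))"
      using D by (simp add: powr_add[symmetric] powr_mult_base add.commute)
    then have "\<bar>g' r\<bar> * B (g r) * D powr (p + q - 1) = r powr (\<rho> - 1) * U powr (p - 1) * V powr (q - 1)"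
      unfolding B_def gr(2) unfolding gr(1) using D pos by (simp add: g'_def powr_divide)
    then show ?thesis by (simp add: katugampola_kernel_def U_def V_def)
  qed
  have hi': "((\<lambda>r. katugampola_kernel \<rho> p t r * rpow_gap \<rho> s r powr (q - 1)) has_integral
        Beta q p * D powr (p + q - 1)) {s<..<t}"
    using has_integral_mult_left[OF hi, of "D powr (p + q - 1)"]
    by (rule has_integral_eq[rotated]) (use eq in auto)
  have pos: "katugampola_kernel \<rho> p t r * rpow_gap \<rho> s r powr (q - 1) \<ge> 0" for r
    by (simp add: katugampola_kernel_nonneg)
  \<comment> \<open>The gauge integral yields integrability for the completed measure only; Borel
    measurability of the integrand brings it back to \<open>lborel\<close>.\<close>
  have "set_integrable lebesgue {s<..<t} (\<lambda>r. katugampola_kernel \<rho> p t r * rpow_gap \<rho> s r powr (q - 1))"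
    using hi' pos by (intro nonnegative_absolutely_integrable_1) (auto simp: has_integral_iff)
  moreover have [measurable]: "(\<lambda>r. katugampola_kernel \<rho> p t r * rpow_gap \<rho> s r powr (q - 1)) \<in> borel_measurable borel"
    by measurable
  ultimately show I: ?I
    unfolding set_integrable_def by (subst (asm) integrable_completion) auto
  show ?E
    using set_borel_integral_eq_integral(2)[OF I] hi' by (auto simp: has_integral_iff D_def Beta_commute)
qed

section \<open>The semigroup law\<close>

text \<open>Exchange the order of integration over the triangle \<open>a < s < r < t\<close>; for
  fixed \<open>s\<close> the integral in \<open>r\<close> is the Beta integral above, which leaves
  the kernel of order \<open>p + q\<close>.\<close>

lemma katugampola_fubini:
  fixes f :: "real \<Rightarrow> real"
  assumes "0 < \<rho>" "0 < a" "a < t" "0 < p" "0 < q"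
    and meas: "set_borel_measurable borel {a<..<t} f"
    and int: "set_integrable lborel {a<..<t} (\<lambda>s. katugampola_kernel \<rho> (p + q) t s * f s)"
  shows "set_integrable lborel {a<..<t}
           (\<lambda>r. katugampola_kernel \<rho> p t r * (LINT s:{a<..<r}|lborel. katugampola_kernel \<rho> q r s * f s))" (is ?I)
    and "(LINT r:{a<..<t}|lborel.
            katugampola_kernel \<rho> p t r * (LINT s:{a<..<r}|lborel. katugampola_kernel \<rho> q r s * f s))
         = Beta p q * (LINT s:{a<..<t}|lborel. katugampola_kernel \<rho> (p + q) t s * f s)" (is ?E)
proof -
  \<comment> \<open>Cutting \<open>f\<close> off gives a function measurable on the whole line; it
    also supplies the constraint \<open>a < s\<close> of the triangle, while \<open>k\<close>
    supplies \<open>s < r < t\<close>.\<close>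
  define f' where "f' s = indicator {a<..<t} s * f s" for s
  have [measurable]: "f' \<in> borel_measurable borel"
    using meas by (simp add: set_borel_measurable_def f'_def[abs_def])
  define k where "k s r = indicator {r. s < r \<and> r < t} r *\<^sub>R
      (katugampola_kernel \<rho> p t r * katugampola_kernel \<rho> q r s)" for s r
  define H where "H = (\<lambda>(s, r). k s r * f' s)"
  have k_nonneg: "0 \<le> k s r" for s r
    by (simp add: k_def katugampola_kernel_nonneg)
  have [measurable]: "case_prod k \<in> borel_measurable (borel \<Otimes>\<^sub>M borel)"
    unfolding k_def indicator_def by measurable
  have H_meas [measurable]: "H \<in> borel_measurable (lborel \<Otimes>\<^sub>M lborel)"
    unfolding H_def by measurable
  have k: "integrable lborel (k s)" "integral\<^sup>L lborel (k s) = Beta p q * katugampola_kernel \<rho> (p + q) t s"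
    if "s \<in> {a<..<t}" for s
  proof -
    have s: "0 < s" "s < t" using that assms by auto
    have *: "k s r = s powr (\<rho> - 1) * (indicator {s<..<t} r *\<^sub>R
         (katugampola_kernel \<rho> p t r * rpow_gap \<rho> s r powr (q - 1)))" for r
      by (simp add: k_def katugampola_kernel_def indicator_def)
    show "integrable lborel (k s)"
      using katugampola_kernel_beta(1)[OF assms(1) s assms(4,5)] unfolding * set_integrable_def
      by (rule integrable_mult_right)
    show "integral\<^sup>L lborel (k s) = Beta p q * katugampola_kernel \<rho> (p + q) t s"
      using katugampola_kernel_beta(2)[OF assms(1) s assms(4,5)] unfolding * set_lebesgue_integral_def
      by (simp add: katugampola_kernel_def)
  qed
  have kf: "integrable lborel (\<lambda>r. k s r * f' s)" for s
    using k(1)[of s] by (cases "s \<in> {a<..<t}") (auto simp: f'_def)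
  have I1: "(\<integral>r. k s r * f' s \<partial>lborel) = Beta p q * (indicator {a<..<t} s *\<^sub>R (katugampola_kernel \<rho> (p + q) t s * f s))" for s
    using k[of s] by (cases "s \<in> {a<..<t}") (auto simp: f'_def)
  \<comment> \<open>Both kernels are nonnegative, so the norm falls on \<open>f\<close> alone and
    the Tonelli condition becomes the assumed integrability at order \<open>p + q\<close>.\<close>
  have I2: "(\<integral>r. norm (H (s, r)) \<partial>lborel) = Beta p q * norm (indicator {a<..<t} s *\<^sub>R (katugampola_kernel \<rho> (p + q) t s * f s))" for s
    using k[of s] k_nonneg[of s] katugampola_kernel_nonneg[of \<rho> "p+q" t s]
    by (cases "s \<in> {a<..<t}") (auto simp: f'_def H_def abs_mult)
  have "integrable (lborel \<Otimes>\<^sub>M lborel) H"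
  proof (rule lborel_pair.Fubini_integrable)
    show "integrable lborel (\<lambda>s. \<integral>r. norm (H (s, r)) \<partial>lborel)"
      unfolding I2 using int by (intro integrable_mult_right integrable_norm) (simp add: set_integrable_def)
  qed (use kf in \<open>auto simp: H_def\<close>)
  then have HI: "integrable (lborel \<Otimes>\<^sub>M lborel) (case_prod (\<lambda>s r. k s r * f' s))"
    by (simp add: H_def)
  have inner: "(\<integral>s. k s r * f' s \<partial>lborel) = indicator {a<..<t} r *\<^sub>R (katugampola_kernel \<rho> p t r *
          (LINT s:{a<..<r}|lborel. katugampola_kernel \<rho> q r s * f s))" for r
  proof -
    have "k s r * f' s = indicator {a<..<t} r * katugampola_kernel \<rho> p t r *
      (indicator {a<..<r} s *\<^sub>R (katugampola_kernel \<rho> q r s * f s))" for s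
      by (auto simp: k_def f'_def indicator_def)
    then show ?thesis by (simp add: set_lebesgue_integral_def)
  qed
  show ?I
    using lborel_pair.integrable_snd[OF HI] unfolding inner set_integrable_def by simp
  show ?E
    using lborel_pair.Fubini_integral[OF HI] unfolding inner I1 set_lebesgue_integral_def by simp
qed

text \<open>The factor \<open>Beta p q\<close> from the exchange of integrals equals
  \<open>Gamma p * Gamma q / Gamma (p + q)\<close>, which is what the normalising constants
  require.\<close>

lemma katugampola_integral_semigroup:
  fixes f :: "real \<Rightarrow> real"
  assumes "0 < \<rho>" "0 < a" "a < t" "0 \<le> p" "0 \<le> q"
    and meas: "set_borel_measurable borel {a<..<t} f"
    and int: "katugampola_integral_exists \<rho> a (p + q) f t"
  shows "katugampola_integral_exists \<rho> a p (katugampola_integral \<rho> a q f) t" (is ?I)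
    and "katugampola_integral \<rho> a p (katugampola_integral \<rho> a q f) t
           = katugampola_integral \<rho> a (p + q) f t" (is ?E)
proof -
  have "?I \<and> ?E"
  \<comment> \<open>Order zero is the identity by definition. It does occur:
    \<open>\<beta> * (1 - \<alpha>)\<close> vanishes for \<open>\<beta> = 0\<close>, and
    \<open>1 - \<gamma>\<close> vanishes for \<open>\<beta> = 1\<close>.\<close>
  proof (cases "p = 0 \<or> q = 0")
    case True
    moreover have "katugampola_integral \<rho> a 0 f = f"
      by (simp add: katugampola_integral_def fun_eq_iff)
    ultimately show ?thesis
      using int by (auto simp: katugampola_integral_exists_def) (auto simp: katugampola_integral_def)
  next
    case False
    then have pq: "p > 0" "q > 0" using assms by auto
    have int': "set_integrable lborel {a<..<t} (\<lambda>s. katugampola_kernel \<rho> (p + q) t s * f s)"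
      using int pq by (simp add: katugampola_integral_exists_def)
    note F = katugampola_fubini[OF assms(1-3) pq meas int']
    have eq: "katugampola_kernel \<rho> p t r * katugampola_integral \<rho> a q f r =
      1 / Gamma q * (katugampola_kernel \<rho> p t r * (LINT s:{a<..<r}|lborel. katugampola_kernel \<rho> q r s * f s))" for r
      using pq by (simp add: katugampola_integral_def)
    have ?I unfolding katugampola_integral_exists_def eq using F(1) by auto
    moreover have "Gamma p \<noteq> 0" "Gamma q \<noteq> 0" "Gamma (p + q) \<noteq> 0"
      using pq Gamma_real_pos[of p] Gamma_real_pos[of q] Gamma_real_pos[of "p + q"] by linarith+
    then have ?E
      using pq unfolding katugampola_integral_def[of _ _ p] katugampola_integral_def[of _ _ "p+q"] eq
      by (simp add: F(2) Beta_def)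
    ultimately show ?thesis ..
  qed
  then show ?I ?E by auto
qed

section \<open>Existence criteria and special cases of the integral\<close>

lemma set_borel_measurable_continuous_on_subset:
  fixes f :: "real \<Rightarrow> real"
  assumes "continuous_on S f" "T \<subseteq> S" "T \<in> sets borel"
  shows "set_borel_measurable borel T f"
  unfolding set_borel_measurable_def
  using assms by (metis borel_measurable_continuous_on_indicator continuous_on_subset)

lemma katugampola_kernel_one: "s < t \<Longrightarrow> 0 < s \<Longrightarrow> 0 < \<rho> \<Longrightarrow> katugampola_kernel \<rho> 1 t s = s powr (\<rho> - 1)"
  using powr_less_mono2[of \<rho> s t] by (simp add: katugampola_kernel_def)

lemma katugampola_integral_exists_one:
  assumes "0 < \<rho>" "0 < a"
  shows "katugampola_integral_exists \<rho> a 1 h t \<longleftrightarrow> set_integrable lborel {a<..<t} (\<lambda>s. s powr (\<rho> - 1) * h s)"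
  unfolding katugampola_integral_exists_def using assms
  by (simp, intro set_integrable_cong) (auto simp: katugampola_kernel_one)

lemma katugampola_integral_one:
  assumes "0 < \<rho>" "0 < a"
  shows "katugampola_integral \<rho> a 1 h t = (LINT s:{a<..<t}|lborel. s powr (\<rho> - 1) * h s)"
  unfolding katugampola_integral_def using assms
  by (simp, intro set_lebesgue_integral_cong) (auto simp: katugampola_kernel_one)

text \<open>The integrand is dominated by a multiple of the Beta integrand. The bound allows the
  singularity at \<open>a\<close> of functions in \<open>weighted_C (1 - \<gamma>)\<close>,
  integrable since \<open>0 < \<gamma>\<close>.\<close>

lemma katugampola_integral_exists_bounded:
  assumes "0 < \<rho>" "0 < a" "a < t" "0 < \<sigma>" "0 < \<gamma>"
    and meas: "set_borel_measurable borel {a<..<t} h"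
    and bound: "\<And>s. s \<in> {a<..<t} \<Longrightarrow> \<bar>h s\<bar> \<le> C * rpow_gap \<rho> a s powr (\<gamma> - 1)"
  shows "katugampola_integral_exists \<rho> a \<sigma> h t"
  unfolding katugampola_integral_exists_def
proof (intro disjI2, rule set_integrable_bound)
  show "set_integrable lborel {a<..<t} (\<lambda>r. C * (katugampola_kernel \<rho> \<sigma> t r * rpow_gap \<rho> a r powr (\<gamma> - 1)))"
    using katugampola_kernel_beta(1)[of \<rho> a t \<sigma> \<gamma>] assms by auto
  have [measurable]: "(\<lambda>s. indicator {a<..<t} s * h s) \<in> borel_measurable borel"
    using meas by (simp add: set_borel_measurable_def)
  have "(\<lambda>s. katugampola_kernel \<rho> \<sigma> t s * (indicator {a<..<t} s * h s)) \<in> borel_measurable lborel"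
    by measurable
  then show "set_borel_measurable lborel {a<..<t} (\<lambda>s. katugampola_kernel \<rho> \<sigma> t s * h s)"
    by (simp add: set_borel_measurable_def mult_ac)
  show "AE s in lborel. s \<in> {a<..<t} \<longrightarrow> norm (katugampola_kernel \<rho> \<sigma> t s * h s)
          \<le> norm (C * (katugampola_kernel \<rho> \<sigma> t s * rpow_gap \<rho> a s powr (\<gamma> - 1)))"
  proof (intro AE_I2 impI)
    fix s assume s: "s \<in> {a<..<t}"
    have "katugampola_kernel \<rho> \<sigma> t s * \<bar>h s\<bar> \<le> katugampola_kernel \<rho> \<sigma> t s * (C * rpow_gap \<rho> a s powr (\<gamma> - 1))"
      using bound[OF s] by (intro mult_left_mono katugampola_kernel_nonneg)
    also have "\<dots> = C * (katugampola_kernel \<rho> \<sigma> t s * rpow_gap \<rho> a s powr (\<gamma> - 1))"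
      by (simp only: mult_ac)
    also have "katugampola_kernel \<rho> \<sigma> t s * \<bar>h s\<bar> = norm (katugampola_kernel \<rho> \<sigma> t s * h s)"
      using katugampola_kernel_nonneg[of \<rho> \<sigma> t s] by (simp add: abs_mult)
    finally show "norm (katugampola_kernel \<rho> \<sigma> t s * h s)
          \<le> norm (C * (katugampola_kernel \<rho> \<sigma> t s * rpow_gap \<rho> a s powr (\<gamma> - 1)))"
      unfolding real_norm_def by linarith
  qed
qed

text \<open>This is the Beta integral with \<open>q = 1\<close>; the quotient
  \<open>Beta \<sigma> 1 / Gamma \<sigma>\<close> is
  \<open>1 / Gamma (\<sigma> + 1)\<close>.\<close>

lemma katugampola_integral_const:
  assumes "0 < \<rho>" "0 < a" "a < t" "0 < \<sigma>"
  shows "katugampola_integral_exists \<rho> a \<sigma> (\<lambda>_. c) t"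
    and "katugampola_integral \<rho> a \<sigma> (\<lambda>_. c) t = c * (Beta \<sigma> 1 / Gamma \<sigma>) * rpow_gap \<rho> a t powr \<sigma>"
proof -
  \<comment> \<open>The gap has to be nonzero here, because \<open>0 powr 0\<close> is
    \<open>0\<close>.\<close>
  have eq: "katugampola_kernel \<rho> \<sigma> t s * c = c * (katugampola_kernel \<rho> \<sigma> t s * rpow_gap \<rho> a s powr (1 - 1))"
    if "s \<in> {a<..<t}" for s
    using powr_less_mono2[of \<rho> a s] that assms by simp
  note B = katugampola_kernel_beta[of \<rho> a t \<sigma> 1]
  show "katugampola_integral_exists \<rho> a \<sigma> (\<lambda>_. c) t"
    unfolding katugampola_integral_exists_def
  proof (rule disjI2, subst set_integrable_cong[OF refl refl eq])
    show "set_integrable lborel {a<..<t} (\<lambda>s. c * (katugampola_kernel \<rho> \<sigma> t s * rpow_gap \<rho> a s powr (1 - 1)))"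
      using B(1) assms by (intro set_integrable_mult_right) (auto simp del: diff_self)
  qed
  have "(LINT s:{a<..<t}|lborel. katugampola_kernel \<rho> \<sigma> t s * c) =
        (LINT s:{a<..<t}|lborel. c * (katugampola_kernel \<rho> \<sigma> t s * rpow_gap \<rho> a s powr (1 - 1)))"
    by (rule set_lebesgue_integral_cong) (use eq in auto)
  also have "\<dots> = c * (Beta \<sigma> 1 * rpow_gap \<rho> a t powr \<sigma>)"
    using B(2) assms by (simp del: diff_self)
  finally show "katugampola_integral \<rho> a \<sigma> (\<lambda>_. c) t = c * (Beta \<sigma> 1 / Gamma \<sigma>) * rpow_gap \<rho> a t powr \<sigma>"
    using assms by (simp add: katugampola_integral_def)
qed

lemma katugampola_integral_add:
  assumes "katugampola_integral_exists \<rho> a \<sigma> g t" "katugampola_integral_exists \<rho> a \<sigma> h t"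
  shows "katugampola_integral \<rho> a \<sigma> (\<lambda>s. g s + h s) t
           = katugampola_integral \<rho> a \<sigma> g t + katugampola_integral \<rho> a \<sigma> h t"
  using assms
  by (auto simp: katugampola_integral_def katugampola_integral_exists_def distrib_left add_divide_distrib)

lemma katugampola_integral_cong:
  assumes "\<sigma> \<noteq> 0" "\<And>s. a < s \<Longrightarrow> s < t \<Longrightarrow> g s = h s"
  shows "katugampola_integral \<rho> a \<sigma> g t = katugampola_integral \<rho> a \<sigma> h t"
  unfolding katugampola_integral_def using assms
  by (auto intro!: set_lebesgue_integral_cong)

section \<open>Weighted continuous functions and the fundamental theorem\<close>

text \<open>Dividing by the weight writes \<open>h\<close> as a continuous function on the compact
  interval, hence a bounded one, times
  \<open>rpow_gap \<rho> a t powr (\<gamma> - 1)\<close>.\<close>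

lemma weighted_C_bound:
  assumes "0 < \<rho>" "0 < a" "a < b" "h \<in> weighted_C (1 - \<gamma>) \<rho> a b"
  shows "continuous_on {a<..b} h"
    and "\<exists>C. \<forall>t\<in>{a<..b}. \<bar>h t\<bar> \<le> C * rpow_gap \<rho> a t powr (\<gamma> - 1)"
proof -
  obtain f where f: "continuous_on {a..b} f" "\<And>t. t \<in> {a<..b} \<Longrightarrow> f t = rpow_gap \<rho> a t powr (1 - \<gamma>) * h t"
    using assms by (auto simp: weighted_C_def)
  have h: "h t = f t * rpow_gap \<rho> a t powr (\<gamma> - 1)" if "t \<in> {a<..b}" for t
  proof -
    have "rpow_gap \<rho> a t powr (1 - \<gamma>) * rpow_gap \<rho> a t powr (\<gamma> - 1) = 1"
      using powr_less_mono2[of \<rho> a t] that assms by (simp add: powr_add[symmetric])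
    then show ?thesis using f(2)[OF that] by (simp add: mult_ac)
  qed
  have "continuous_on {a<..b} (\<lambda>t. f t * rpow_gap \<rho> a t powr (\<gamma> - 1))"
    using rpow_gap_pos[of \<rho> a] assms
    by (intro continuous_intros continuous_on_subset[OF f(1)]) force+
  then show "continuous_on {a<..b} h"
    by (rule continuous_on_eq) (simp only: h)
  have "bounded (f ` {a..b})"
    using f(1) compact_continuous_image compact_imp_bounded compact_Icc by blast
  then obtain C where "\<forall>t\<in>{a..b}. \<bar>f t\<bar> \<le> C"
    unfolding bounded_iff by auto
  then show "\<exists>C. \<forall>t\<in>{a<..b}. \<bar>h t\<bar> \<le> C * rpow_gap \<rho> a t powr (\<gamma> - 1)"
    using h by (intro exI[of _ C]) (auto simp: abs_mult intro!: mult_right_mono)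
qed

text \<open>The weight \<open>s powr (\<rho> - 1)\<close> of the integral of order one cancels the
  factor \<open>s powr (1 - \<rho>)\<close> in \<open>delta_op\<close>, leaving the ordinary
  derivative of \<open>y\<close>. The improper form of the fundamental theorem applies, with the
  limit \<open>ya\<close> in place of a value at \<open>a\<close>.\<close>

lemma katugampola_FTC:
  assumes "0 < \<rho>" "0 < a" "a < t"
    and diff: "\<And>s. a < s \<Longrightarrow> y differentiable (at s within {a<..})"
    and cont: "continuous_on {a<..} (delta_op \<rho> {a<..} y)"
    and ex: "katugampola_integral_exists \<rho> a 1 (delta_op \<rho> {a<..} y) t"
    and lim: "(y \<longlongrightarrow> ya) (at_right a)"
  shows "y t = ya + katugampola_integral \<rho> a 1 (delta_op \<rho> {a<..} y) t"
proof -
  let ?f = "\<lambda>s. s powr (\<rho> - 1) * delta_op \<rho> {a<..} y s"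
  have der: "(y has_vector_derivative ?f s) (at s)" if "a < s" for s
  proof -
    have *: "at s within {a<..} = at s" using that by (intro at_within_open) auto
    have "?f s = vector_derivative y (at s)"
      using that assms by (simp add: delta_op_def * mult.assoc[symmetric] powr_add[symmetric])
    then show ?thesis
      using diff[OF that] unfolding * by (simp add: vector_derivative_works)
  qed
  have yt: "(y \<longlongrightarrow> y t) (at_left t)"
    using has_vector_derivative_continuous[OF der[OF assms(3)]]
    by (metis continuous_within filterlim_at_split)
  have "(LBINT s=ereal a..ereal t. ?f s) = y t - ya"
  proof (rule interval_integral_FTC_integrable)
    fix s assume "ereal a < ereal s"
    then have s: "a < s" by simp
    show "(y has_vector_derivative ?f s) (at s)" using der s by simp
    have "isCont (delta_op \<rho> {a<..} y) s"
      using cont s by (metis continuous_on_eq_continuous_at greaterThan_iff open_greaterThan)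
    then show "isCont ?f s" using s assms by (intro continuous_intros) auto
  qed (use assms yt in \<open>auto simp: ereal_tendsto_simps1 katugampola_integral_exists_one\<close>)
  moreover have "(LBINT s=ereal a..ereal t. ?f s) = katugampola_integral \<rho> a 1 (delta_op \<rho> {a<..} y) t"
    using assms by (simp add: katugampola_integral_one interval_integral_eq_integral interval_lebesgue_integral_def)
  ultimately show ?thesis by simp
qed

section \<open>Lower bound and differentiation of integrals\<close>

text \<open>Since \<open>\<alpha> - 1\<close> is nonpositive and \<open>rpow_gap \<rho> s t\<close>
  is at most \<open>rpow_gap \<rho> a t\<close>, the singular factor of the kernel is smallest at
  \<open>s = a\<close>. The same comparison yields integrability of \<open>h\<close>, by
  domination.\<close>

lemma katugampola_integral_ge:
  assumes "0 < \<rho>" "0 < a" "a < t" "0 < \<alpha>" "\<alpha> \<le> 1"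
    and ex: "katugampola_integral_exists \<rho> a \<alpha> g t"
    and meas: "set_borel_measurable borel {a<..<t} h"
    and h: "\<And>s. s \<in> {a<..<t} \<Longrightarrow> 0 \<le> h s \<and> h s \<le> g s"
  shows "set_integrable lborel {a<..<t} (\<lambda>s. s powr (\<rho> - 1) * h s)"
    and "katugampola_integral \<rho> a \<alpha> g t \<ge>
           1 / Gamma \<alpha> * rpow_gap \<rho> a t powr (\<alpha> - 1) * (LINT s:{a<..<t}|lborel. s powr (\<rho> - 1) * h s)"
proof -
  define T where "T = rpow_gap \<rho> a t"
  have T: "T > 0" using rpow_gap_pos[of \<rho> a t] assms by (simp add: T_def)
  have le: "T powr (\<alpha> - 1) * (s powr (\<rho> - 1) * h s) \<le> katugampola_kernel \<rho> \<alpha> t s * g s"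
    if s: "s \<in> {a<..<t}" for s
  proof -
    have "rpow_gap \<rho> s t \<le> T" unfolding T_def
      using s assms by (intro divide_right_mono diff_left_mono powr_mono2) auto
    then have "T powr (\<alpha> - 1) \<le> rpow_gap \<rho> s t powr (\<alpha> - 1)"
      using rpow_gap_pos[of \<rho> s t] s assms by (intro powr_mono2') auto
    then have "T powr (\<alpha> - 1) * (s powr (\<rho> - 1) * h s) \<le> rpow_gap \<rho> s t powr (\<alpha> - 1) * (s powr (\<rho> - 1) * g s)"
      using h[OF s] by (intro mult_mono) auto
    then show ?thesis by (simp add: katugampola_kernel_def mult_ac)
  qed
  have exg: "set_integrable lborel {a<..<t} (\<lambda>s. katugampola_kernel \<rho> \<alpha> t s * g s)"
    using ex assms by (simp add: katugampola_integral_exists_def)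
  have [measurable]: "(\<lambda>s. indicator {a<..<t} s * h s) \<in> borel_measurable borel"
    using meas by (simp add: set_borel_measurable_def)
  have I: "set_integrable lborel {a<..<t} (\<lambda>s. T powr (\<alpha> - 1) * (s powr (\<rho> - 1) * h s))"
  proof (rule set_integrable_bound[OF exg])
    have "(\<lambda>s. T powr (\<alpha> - 1) * (s powr (\<rho> - 1) * (indicator {a<..<t} s * h s))) \<in> borel_measurable lborel"
      by measurable
    then show "set_borel_measurable lborel {a<..<t} (\<lambda>s. T powr (\<alpha> - 1) * (s powr (\<rho> - 1) * h s))"
      by (simp add: set_borel_measurable_def mult_ac)
    show "AE s in lborel. s \<in> {a<..<t} \<longrightarrow> norm (T powr (\<alpha> - 1) * (s powr (\<rho> - 1) * h s))
              \<le> norm (katugampola_kernel \<rho> \<alpha> t s * g s)"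
    proof (intro AE_I2 impI)
      fix s assume s: "s \<in> {a<..<t}"
      have "0 \<le> T powr (\<alpha> - 1) * (s powr (\<rho> - 1) * h s)" using h[OF s] by simp
      then show "norm (T powr (\<alpha> - 1) * (s powr (\<rho> - 1) * h s)) \<le> norm (katugampola_kernel \<rho> \<alpha> t s * g s)"
        using le[OF s] by simp
    qed
  qed
  then show "set_integrable lborel {a<..<t} (\<lambda>s. s powr (\<rho> - 1) * h s)"
    using T by simp
  have "T powr (\<alpha> - 1) * (LINT s:{a<..<t}|lborel. s powr (\<rho> - 1) * h s)
     \<le> (LINT s:{a<..<t}|lborel. katugampola_kernel \<rho> \<alpha> t s * g s)"
    using set_integral_mono[OF I exg le] by simp
  then show "katugampola_integral \<rho> a \<alpha> g t \<ge>
           1 / Gamma \<alpha> * rpow_gap \<rho> a t powr (\<alpha> - 1) * (LINT s:{a<..<t}|lborel. s powr (\<rho> - 1) * h s)"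
    using assms Gamma_real_pos[of \<alpha>]
    by (simp add: katugampola_integral_def T_def[symmetric] divide_right_mono)
qed

text \<open>As \<open>w\<close> may be singular at \<open>a\<close>, the integral up to a fixed
  \<open>c\<close> between \<open>a\<close> and \<open>t\<close> is split off as a constant; on the
  rest \<open>w\<close> is continuous on compact intervals.\<close>

lemma lebesgue_integral_has_real_derivative:
  fixes w :: "real \<Rightarrow> real"
  assumes cont: "continuous_on {a<..} w"
    and int: "\<And>t. a < t \<Longrightarrow> set_integrable lborel {a<..<t} w"
    and "a < t"
  shows "((\<lambda>t. LINT s:{a<..<t}|lborel. w s) has_real_derivative w t) (at t)"
proof -
  obtain c where c: "a < c" "c < t" using \<open>a < t\<close> dense by blast
  have eq: "(LINT s:{a<..<u}|lborel. w s) = (LINT s:{a<..<c}|lborel. w s) + integral {c..u} w" if "c < u" for u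
  proof -
    have I: "set_integrable lborel {c..<u} w"
      by (rule set_integrable_subset[OF int[of u]]) (use c that in auto)
    have "{a<..<u} = {a<..<c} \<union> {c..<u}" using c that by auto
    then have "(LINT s:{a<..<u}|lborel. w s) = (LINT s:{a<..<c}|lborel. w s) + (LINT s:{c..<u}|lborel. w s)"
      using int[of c] c I by (simp only:, intro set_integral_Un) auto
    also have "(LINT s:{c..<u}|lborel. w s) = integral {c..<u} w"
      using I by (rule set_borel_integral_eq_integral)
    also have "\<dots> = integral {c..u} w"
      by (rule integral_spike_set) (auto intro: negligible_subset[of "{u}"])
    finally show ?thesis .
  qed
  have "((\<lambda>u. integral {c..u} w) has_real_derivative w t) (at t within {c..t+1})"
    by (rule integral_has_real_derivative) (use c in \<open>auto intro: continuous_on_subset[OF cont]\<close>)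
  moreover have "at t within {c..t+1} = at t"
    using c by (simp add: at_within_Icc_at)
  ultimately have "((\<lambda>u. (LINT s:{a<..<c}|lborel. w s) + integral {c..u} w) has_real_derivative w t) (at t)"
    by (auto intro!: derivative_eq_intros)
  then show ?thesis
    by (rule has_field_derivative_transform_within_open[of _ _ _ "{c<..}"]) (use c eq in auto)
qed

section \<open>Blow-up of a differential inequality\<close>

lemma filterlim_powr_at_top:
  assumes "0 < (p :: real)"
  shows "filterlim (\<lambda>x. x powr p) at_top at_top"
proof -
  have "filterlim (\<lambda>x. exp (p * ln x)) at_top at_top"
    by (intro filterlim_compose[OF exp_at_top] filterlim_tendsto_pos_mult_at_top[OF tendsto_const assms] ln_at_top)
  moreover have "eventually (\<lambda>x. exp (p * ln x) = x powr p) at_top"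
    using eventually_gt_at_top[of 0] by eventually_elim (simp add: powr_def)
  ultimately show ?thesis
    by (simp cong: filterlim_cong)
qed

text \<open>Bernoulli's substitution: \<open>F t powr (1 - m)\<close> decreases at least as fast as
  a multiple of \<open>rpow_gap \<rho> a t powr (\<theta> + 1)\<close> grows. That multiple is
  unbounded, yet \<open>F t powr (1 - m)\<close> stays nonnegative.\<close>

lemma power_differential_inequality_blow_up:
  assumes "0 < \<rho>" "0 < a" "a < t0" "0 < k" "-1 < \<theta>" "1 < m"
    and F: "\<And>t. t0 \<le> t \<Longrightarrow> 0 < F t"
    and der: "\<And>t. t0 \<le> t \<Longrightarrow> (F has_real_derivative w t) (at t)"
    and w: "\<And>t. t0 \<le> t \<Longrightarrow> k * t powr (\<rho> - 1) * rpow_gap \<rho> a t powr \<theta> * F t powr m \<le> w t"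
  shows False
proof -
  \<comment> \<open>Chosen so that the second summand of \<open>\<Phi>\<close> has derivative
    \<open>(m - 1) * B\<close>, with \<open>B\<close> the lower bound for
    \<open>w s * F s powr (- m)\<close>.\<close>
  define C where "C = (m - 1) * k / (\<theta> + 1)"
  have C: "C > 0" using assms by (simp add: C_def)
  define \<Phi> where "\<Phi> t = F t powr (1 - m) + C * rpow_gap \<rho> a t powr (\<theta> + 1)" for t
  have mono: "\<Phi> t \<le> \<Phi> t0" if "t0 \<le> t" for t
  proof (rule DERIV_nonpos_imp_nonincreasing[OF that])
    fix s assume s: "t0 \<le> s" "s \<le> t"
    have pos: "0 < s" "0 < rpow_gap \<rho> a s" "0 < F s"
      using s assms rpow_gap_pos[of \<rho> a s] F by auto
    define A where "A = w s * F s powr (- m)"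
    define B where "B = k * s powr (\<rho> - 1) * rpow_gap \<rho> a s powr \<theta>"
    have "(\<Phi> has_real_derivative
            (1 - m) * F s powr (1 - m - 1) * w s
            + C * ((\<theta> + 1) * rpow_gap \<rho> a s powr (\<theta> + 1 - 1) * s powr (\<rho> - 1))) (at s)"
      unfolding \<Phi>_def
      by (intro DERIV_add DERIV_cmult DERIV_chain2[OF has_real_derivative_powr]
            has_real_derivative_powr[THEN DERIV_chain2] der s pos rpow_gap_deriv assms)
    also have "(1 - m) * F s powr (1 - m - 1) * w s = (1 - m) * A"
      by (simp add: A_def)
    also have "C * ((\<theta> + 1) * rpow_gap \<rho> a s powr (\<theta> + 1 - 1) * s powr (\<rho> - 1)) = (m - 1) * B"
      using assms by (simp add: C_def B_def)
    finally have D: "(\<Phi> has_real_derivative (1 - m) * A + (m - 1) * B) (at s)" .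
    have "F s powr m * F s powr (- m) = 1" using pos by (simp add: powr_add[symmetric])
    then have "B \<le> A"
      using mult_right_mono[OF w[OF s(1)], of "F s powr (- m)"] by (simp add: mult.assoc A_def B_def)
    then have "(m - 1) * B \<le> (m - 1) * A"
      using assms by (intro mult_left_mono) auto
    then have "(1 - m) * A + (m - 1) * B \<le> 0" by (simp add: algebra_simps)
    then show "\<exists>y. (\<Phi> has_real_derivative y) (at s) \<and> y \<le> 0"
      using D by blast
  qed
  have "filterlim (\<lambda>t. C * rpow_gap \<rho> a t powr (\<theta> + 1)) at_top at_top"
  proof (intro filterlim_tendsto_pos_mult_at_top[OF tendsto_const C] filterlim_compose[OF filterlim_powr_at_top])
    have "filterlim (\<lambda>t. 1 / \<rho> * (- (a powr \<rho>) + t powr \<rho>)) at_top at_top"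
      using assms
      by (intro filterlim_tendsto_pos_mult_at_top[OF tendsto_const]
            filterlim_tendsto_add_at_top[OF tendsto_const] filterlim_powr_at_top) auto
    then show "filterlim (rpow_gap \<rho> a) at_top at_top" by simp
  qed (use assms in auto)
  then have "eventually (\<lambda>t. \<Phi> t0 < C * rpow_gap \<rho> a t powr (\<theta> + 1)) at_top"
    by (simp add: filterlim_at_top_dense)
  then have "eventually (\<lambda>t. \<Phi> t0 < C * rpow_gap \<rho> a t powr (\<theta> + 1) \<and> t0 \<le> t) at_top"
    using eventually_ge_at_top by (rule eventually_conj)
  then obtain t where t: "\<Phi> t0 < C * rpow_gap \<rho> a t powr (\<theta> + 1)" "t0 \<le> t"
    using eventually_happens trivial_limit_at_top_linorder by blast
  then show False using mono[of t] by (simp add: \<Phi>_def[of t]) (smt (verit) powr_ge_zero)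
qed

section \<open>Integral representation of a solution\<close>

lemma continuous_on_greaterThanI:
  fixes h :: "real \<Rightarrow> real"
  assumes "\<And>b. a < b \<Longrightarrow> continuous_on {a<..<b} h"
  shows "continuous_on {a<..} h"
proof (rule continuous_at_imp_continuous_on, rule ballI)
  fix t assume "t \<in> {a<..}"
  then show "isCont h t"
    using assms[of "t + 1"] by (auto simp: continuous_on_eq_continuous_at)
qed

text \<open>The last identity stays under an integral of order one: the semigroup law turns
  \<open>\<gamma>\<close> and \<open>1 - \<gamma>\<close> into order one on the side of
  \<open>x\<close>, and continuity of the integral of order \<open>\<gamma>\<close> of
  \<open>f\<close>, which would allow differentiating, is not established.\<close>

lemma katugampola_integral_representation:
  fixes x :: "real \<Rightarrow> real"
  assumes "0 < \<rho>" "0 < a" "0 < \<gamma>" "\<gamma> \<le> 1"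
    and weighted: "\<forall>b>a. x \<in> weighted_C_gamma \<gamma> \<rho> a b"
    and diff: "katugampola_deriv_exists_on \<rho> a {a<..} \<gamma> x"
    and init: "(katugampola_integral \<rho> a (1 - \<gamma>) x \<longlongrightarrow> xa) (at_right a)"
  defines "f \<equiv> katugampola_deriv \<rho> a {a<..} \<gamma> x"
  shows "continuous_on {a<..} f"
    and "\<And>\<sigma> t. 0 < \<sigma> \<Longrightarrow> a < t \<Longrightarrow> katugampola_integral_exists \<rho> a \<sigma> f t"
    and "continuous_on {a<..} x"
    and "\<And>t. a < t \<Longrightarrow> katugampola_integral_exists \<rho> a 1 x t"
    and "\<And>t. a < t \<Longrightarrow> katugampola_integral \<rho> a 1 x t =
           xa * (Beta \<gamma> 1 / Gamma \<gamma>) * rpow_gap \<rho> a t powr \<gamma>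
           + katugampola_integral \<rho> a 1 (katugampola_integral \<rho> a \<gamma> f) t"
proof -
  define y where "y = katugampola_integral \<rho> a (1 - \<gamma>) x"
  have f_y: "f = delta_op \<rho> {a<..} y"
    by (simp add: f_def y_def katugampola_deriv_def)
  have x_w: "x \<in> weighted_C (1 - \<gamma>) \<rho> a b"
    and D_w: "katugampola_deriv \<rho> a {a<..b} \<gamma> x \<in> weighted_C (1 - \<gamma>) \<rho> a b" if "a < b" for b
    using weighted that by (auto simp: weighted_C_gamma_def)
  \<comment> \<open>At \<open>t = b\<close> the left side is a one-sided derivative, so the
    comparison is made on the open interval only.\<close>
  have f_eq: "katugampola_deriv \<rho> a {a<..b} \<gamma> x t = f t" if "a < t" "t < b" for t b
  proof -
    have "at t within {a<..b} = at t within {a<..}"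
      using that by (intro at_within_nhd[of _ "{a<..<b}"]) auto
    then show ?thesis by (simp add: f_def katugampola_deriv_def delta_op_def)
  qed
  have f_cont_b: "continuous_on {a<..<b} f" if "a < b" for b
    using continuous_on_subset[OF weighted_C_bound(1)[OF assms(1,2) that D_w[OF that]], of "{a<..<b}"]
    by (rule continuous_on_eq) (auto simp: f_eq)
  then show f_cont: "continuous_on {a<..} f"
    by (rule continuous_on_greaterThanI)
  have "continuous_on {a<..<b} x" if "a < b" for b
    using continuous_on_subset[OF weighted_C_bound(1)[OF assms(1,2) that x_w[OF that]], of "{a<..<b}"]
    by (simp add: subset_eq)
  then show x_cont: "continuous_on {a<..} x"
    by (rule continuous_on_greaterThanI)
  have f_meas: "set_borel_measurable borel {a<..<t} f" and x_meas: "set_borel_measurable borel {a<..<t} x" for t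
    using f_cont x_cont by (auto intro!: set_borel_measurable_continuous_on_subset[of "{a<..}"])
  show f_ex: "katugampola_integral_exists \<rho> a \<sigma> f t" if \<sigma>: "0 < \<sigma>" and t: "a < t" for \<sigma> t
  proof -
    obtain C where C: "\<And>s. s \<in> {a<..t} \<Longrightarrow>
        \<bar>katugampola_deriv \<rho> a {a<..t} \<gamma> x s\<bar> \<le> C * rpow_gap \<rho> a s powr (\<gamma> - 1)"
      using weighted_C_bound(2)[OF assms(1,2) t D_w[OF t]] by blast
    have "\<bar>f s\<bar> \<le> C * rpow_gap \<rho> a s powr (\<gamma> - 1)" if "s \<in> {a<..<t}" for s
      using C[of s] f_eq[of s t] that by simp
    then show ?thesis
      by (rule katugampola_integral_exists_bounded[OF assms(1,2) t \<sigma> assms(3) f_meas])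
  qed
  show x_ex: "katugampola_integral_exists \<rho> a 1 x t" if t: "a < t" for t
  proof -
    obtain C where C: "\<And>s. s \<in> {a<..t} \<Longrightarrow> \<bar>x s\<bar> \<le> C * rpow_gap \<rho> a s powr (\<gamma> - 1)"
      using weighted_C_bound(2)[OF assms(1,2) t x_w[OF t]] by blast
    show ?thesis
      by (rule katugampola_integral_exists_bounded[where \<gamma> = \<gamma> and C = C])
         (use t assms x_meas C in auto)
  qed
  have y_eq: "y s = xa + katugampola_integral \<rho> a 1 f s" if "a < s" for s
    unfolding f_y
  proof (rule katugampola_FTC)
    show "continuous_on {a<..} (delta_op \<rho> {a<..} y)" "katugampola_integral_exists \<rho> a 1 (delta_op \<rho> {a<..} y) s"
      using f_cont f_ex[of 1 s] that by (simp_all add: f_y)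
  qed (use assms that diff init in \<open>auto simp: y_def katugampola_deriv_exists_on_def\<close>)
  fix t assume t: "a < t"
  have "katugampola_integral \<rho> a 1 x t = katugampola_integral \<rho> a \<gamma> y t"
    using katugampola_integral_semigroup(2)[of \<rho> a t \<gamma> "1 - \<gamma>" x] assms t x_meas x_ex[OF t] by (simp add: y_def)
  also have "\<dots> = katugampola_integral \<rho> a \<gamma> (\<lambda>s. xa + katugampola_integral \<rho> a 1 f s) t"
    using assms y_eq by (intro katugampola_integral_cong) auto
  also have "\<dots> = katugampola_integral \<rho> a \<gamma> (\<lambda>_. xa) t + katugampola_integral \<rho> a \<gamma> (katugampola_integral \<rho> a 1 f) t"
    using katugampola_integral_semigroup(1)[of \<rho> a t \<gamma> 1 f] assms t f_meas f_ex
    by (intro katugampola_integral_add katugampola_integral_const) auto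
  \<comment> \<open>Two uses of the semigroup law, through order \<open>\<gamma> + 1\<close>, make
    the two integrals commute.\<close>
  also have "katugampola_integral \<rho> a \<gamma> (katugampola_integral \<rho> a 1 f) t = katugampola_integral \<rho> a (\<gamma> + 1) f t"
    using katugampola_integral_semigroup(2)[of \<rho> a t \<gamma> 1 f] assms t f_meas f_ex by simp
  also have "\<dots> = katugampola_integral \<rho> a 1 (katugampola_integral \<rho> a \<gamma> f) t"
    using katugampola_integral_semigroup(2)[of \<rho> a t 1 \<gamma> f] assms t f_meas f_ex by (simp add: add.commute)
  also have "katugampola_integral \<rho> a \<gamma> (\<lambda>_. xa) t = xa * (Beta \<gamma> 1 / Gamma \<gamma>) * rpow_gap \<rho> a t powr \<gamma>"
    using assms t by (intro katugampola_integral_const) auto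
  finally show "katugampola_integral \<rho> a 1 x t =
           xa * (Beta \<gamma> 1 / Gamma \<gamma>) * rpow_gap \<rho> a t powr \<gamma>
           + katugampola_integral \<rho> a 1 (katugampola_integral \<rho> a \<gamma> f) t" .
qed

section \<open>From integrated to pointwise inequalities\<close>

text \<open>A failure at \<open>t\<close> persists by continuity of \<open>v\<close> and
  \<open>G\<close> on a short interval to the right, where \<open>u - v\<close> then stays above a
  positive constant, against the comparison of increments. Continuity is asked of the minorant
  \<open>G\<close> since in the application \<open>u\<close> contains the fractional integral of
  \<open>f\<close>.\<close>

lemma pointwise_ge_of_integral_increments:
  fixes v u G :: "real \<Rightarrow> real"
  assumes cont: "continuous_on {a<..} v" "continuous_on {a<..} G"
    and int_v: "\<And>t. a < t \<Longrightarrow> set_integrable lborel {a<..<t} v"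
    and int_u: "\<And>t. a < t \<Longrightarrow> set_integrable lborel {a<..<t} u"
    and incr: "\<And>s t. a < s \<Longrightarrow> s < t \<Longrightarrow>
        (LINT r:{a<..<t}|lborel. u r) - (LINT r:{a<..<s}|lborel. u r)
        \<le> (LINT r:{a<..<t}|lborel. v r) - (LINT r:{a<..<s}|lborel. v r)"
    and G: "\<And>t. a < t \<Longrightarrow> G t \<le> u t"
    and "a < t"
  shows "G t \<le> v t"
proof (rule ccontr)
  assume "\<not> G t \<le> v t"
  define e where "e = (G t - v t) / 2"
  have e: "e > 0" using \<open>\<not> G t \<le> v t\<close> by (simp add: e_def)
  have "((\<lambda>s. G s - v s) \<longlongrightarrow> G t - v t) (at t)"
    using cont \<open>a < t\<close>
    by (metis tendsto_diff isCont_def continuous_on_eq_continuous_at greaterThan_iff open_greaterThan)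
  then have "((\<lambda>s. G s - v s) \<longlongrightarrow> G t - v t) (nhds t)"
    using tendsto_at_iff_tendsto_nhds[of "\<lambda>s. G s - v s" t] by simp
  then have "eventually (\<lambda>s. e < G s - v s) (nhds t)"
    using e by (elim order_tendstoD(1)) (simp add: e_def)
  then obtain d where d: "d > 0" "\<And>s. \<bar>s - t\<bar> < d \<Longrightarrow> e < G s - v s"
    by (auto simp: eventually_nhds_metric dist_real_def)
  define t' where "t' = t + d / 2"
  have t': "t < t'" "\<And>s. s \<in> {t..<t'} \<Longrightarrow> e \<le> u s - v s"
  proof -
    show "t < t'" using d by (simp add: t'_def)
    fix s assume "s \<in> {t..<t'}"
    then show "e \<le> u s - v s"
      using d(2)[of s] G[of s] \<open>a < t\<close> d(1) by (auto simp: t'_def)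
  qed
  have sub: "set_integrable lborel {t..<t'} w"
    and split: "(LINT r:{a<..<t'}|lborel. w r) - (LINT r:{a<..<t}|lborel. w r) = (LINT r:{t..<t'}|lborel. w r)"
    if w: "\<And>s. a < s \<Longrightarrow> set_integrable lborel {a<..<s} w" for w :: "real \<Rightarrow> real"
  proof -
    show I: "set_integrable lborel {t..<t'} w"
      by (rule set_integrable_subset[OF w[of t']]) (use t' \<open>a < t\<close> in auto)
    have "{a<..<t'} = {a<..<t} \<union> {t..<t'}" using t' \<open>a < t\<close> by auto
    then have "(LINT r:{a<..<t'}|lborel. w r) = (LINT r:{a<..<t}|lborel. w r) + (LINT r:{t..<t'}|lborel. w r)"
      using w[of t] \<open>a < t\<close> I by (simp only:, intro set_integral_Un) auto
    then show "(LINT r:{a<..<t'}|lborel. w r) - (LINT r:{a<..<t}|lborel. w r) = (LINT r:{t..<t'}|lborel. w r)"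
      by simp
  qed
  have "set_integrable lborel {t..<t'} (\<lambda>_. e)"
    unfolding set_integrable_def using t'(1)
    by (intro integrable_scaleR_left integrable_real_indicator) (auto simp: emeasure_lborel_Ico less_imp_le)
  then have "(LINT r:{t..<t'}|lborel. e) \<le> (LINT r:{t..<t'}|lborel. u r - v r)"
    using t' sub[OF int_u] sub[OF int_v] by (intro set_integral_mono) auto
  also have "\<dots> \<le> 0"
    using sub[OF int_u] sub[OF int_v] incr[OF \<open>a < t\<close> t'(1)] split[OF int_u] split[OF int_v] by simp
  finally have "(t' - t) * e \<le> 0"
    using t'(1) by (simp add: set_integral_const emeasure_lborel_Ico less_imp_le)
  moreover have "0 < (t' - t) * e" using e t'(1) by simp
  ultimately show False by linarith
qed

section \<open>Nonexistence of global solutions\<close>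

theorem theorem3p1:
  fixes a \<rho> \<alpha> \<beta> \<mu> m xa :: real
  assumes "a > 0" and "\<rho> > 0"
    and "0 < \<alpha>" and "\<alpha> < 1" and "0 \<le> \<beta>" and "\<beta> \<le> 1"
    and "\<mu> > - \<alpha>" and "1 < m" and "m < (1 + \<mu>) / (1 - \<alpha>)"
    and "xa > 0"
  shows "\<not> (\<exists>x :: real \<Rightarrow> real. (\<exists>t>a. x t \<noteq> 0) \<and> global_solution \<rho> a \<alpha> \<beta> \<mu> m xa x)"
proof (rule notI, elim exE conjE)
  fix x :: "real \<Rightarrow> real" and t1
  assume t1: "a < t1" "x t1 \<noteq> 0" and sol: "global_solution \<rho> a \<alpha> \<beta> \<mu> m xa x"
  define \<gamma> where "\<gamma> = \<alpha> + \<beta> - \<alpha> * \<beta>"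
  \<comment> \<open>The first identity makes the inner derivative of type \<open>\<beta>\<close>
    equal to \<open>f\<close>; the second splits the integral of order \<open>\<gamma>\<close> of
    \<open>f\<close> into one of order \<open>\<alpha>\<close> applied to \<open>g\<close>.\<close>
  have exponents: "(1 - \<beta>) * (1 - \<alpha>) = 1 - \<gamma>" "\<alpha> + \<beta> * (1 - \<alpha>) = \<gamma>"
    by (simp_all add: \<gamma>_def algebra_simps)
  have \<beta>\<alpha>: "0 \<le> \<beta> * (1 - \<alpha>)" "0 \<le> (1 - \<beta>) * (1 - \<alpha>)" using assms by simp_all
  then have \<gamma>: "0 < \<gamma>" "\<gamma> \<le> 1"
    using assms(3) by (simp_all add: exponents(1) flip: exponents(2))
  define f where "f = katugampola_deriv \<rho> a {a<..} \<gamma> x"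
  define g where "g = katugampola_integral \<rho> a (\<beta> * (1 - \<alpha>)) f"
  define h where "h t = rpow_gap \<rho> a t powr \<mu> * \<bar>x t\<bar> powr m" for t
  have weighted: "\<forall>b>a. x \<in> weighted_C_gamma \<gamma> \<rho> a b"
    and diff: "katugampola_deriv_exists_on \<rho> a {a<..} \<gamma> x"
    and init: "(katugampola_integral \<rho> a (1 - \<gamma>) x \<longlongrightarrow> xa) (at_right a)"
    and ineq: "\<And>t. a < t \<Longrightarrow> h t \<le> g t"
    using sol
    by (auto simp: global_solution_def Let_def \<gamma>_def[symmetric] gen_katugampola_deriv_exists_on_def
        katugampola_deriv_exists_on_def gen_katugampola_deriv_def exponents g_def f_def h_def katugampola_deriv_def)
  note R = katugampola_integral_representation[OF assms(2,1) \<gamma> weighted diff init, folded f_def]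
  have f_meas: "set_borel_measurable borel {a<..<t} f" for t
    using R(1) by (auto intro!: set_borel_measurable_continuous_on_subset[of "{a<..}"])
  have gap_pos: "0 < rpow_gap \<rho> a t" "0 < t" "t powr \<rho> \<noteq> a powr \<rho>" if "a < t" for t
    using rpow_gap_pos[of \<rho> a t] powr_less_mono2[of \<rho> a t] that assms by auto
  have h_cont: "continuous_on {a<..} h"
  proof -
    have "continuous_on {a<..} (\<lambda>t. rpow_gap \<rho> a t powr \<mu>)"
      using gap_pos(2,3) assms by (intro continuous_intros) auto
    \<comment> \<open>The base may vanish here, so continuity rests on the positive exponent; for
      the gap, where \<open>\<mu>\<close> may be negative, it rests on the base being
      nonzero.\<close>
    moreover have "continuous_on {a<..} (\<lambda>t. \<bar>x t\<bar> powr m)"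
      using assms by (intro continuous_on_powr' continuous_intros R(3)) auto
    ultimately show ?thesis
      unfolding h_def by (rule continuous_on_mult)
  qed
  have h_meas: "set_borel_measurable borel {a<..<t} h" for t
    using h_cont by (auto intro!: set_borel_measurable_continuous_on_subset[of "{a<..}"])
  define w where "w t = t powr (\<rho> - 1) * h t" for t
  have w_nonneg: "0 \<le> w t" for t by (simp add: w_def h_def)
  have w_cont: "continuous_on {a<..} w"
    unfolding w_def using gap_pos(2) by (intro continuous_intros h_cont) auto
  define F where "F t = (LINT s:{a<..<t}|lborel. w s)" for t
  have g_ex: "katugampola_integral_exists \<rho> a \<alpha> g t"
    and I_eq: "katugampola_integral \<rho> a \<gamma> f t = katugampola_integral \<rho> a \<alpha> g t" if "a < t" for t
    using katugampola_integral_semigroup[of \<rho> a t \<alpha> "\<beta> * (1 - \<alpha>)" f] R(2)[OF \<gamma>(1) that] assms \<beta>\<alpha> that f_meas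
    by (simp_all add: exponents g_def)
  define c where "c = 1 / Gamma \<alpha>"
  have c: "0 < c" using Gamma_real_pos[of \<alpha>] assms by (simp add: c_def)
  have w_int: "set_integrable lborel {a<..<t} w"
    and I_ge: "c * rpow_gap \<rho> a t powr (\<alpha> - 1) * F t \<le> katugampola_integral \<rho> a \<gamma> f t" if "a < t" for t
    using katugampola_integral_ge[of \<rho> a t \<alpha> g h] ineq g_ex[OF that] h_meas assms that
    by (auto simp: I_eq[OF that] F_def w_def[abs_def] c_def h_def)
  have F_der: "(F has_real_derivative w t) (at t)" if "a < t" for t
    unfolding F_def using w_cont w_int that by (rule lebesgue_integral_has_real_derivative)
  then have F_cont: "continuous_on {a<..} F"
    by (intro DERIV_continuous_on[of _ _ w]) (auto intro: has_field_derivative_at_within)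
  have F_mono: "F s \<le> F t" if "a < s" "s \<le> t" for s t
    using that(2) by (rule DERIV_nonneg_imp_nondecreasing) (use that F_der w_nonneg in \<open>meson less_le_trans\<close>)
  have F_nonneg: "0 \<le> F t" for t
    unfolding F_def set_lebesgue_integral_def using w_nonneg by (intro integral_nonneg_AE) auto
  have x_ge: "c * rpow_gap \<rho> a t powr (\<alpha> - 1) * F t \<le> x t" if "a < t" for t
  proof -
    have "t powr (\<rho> - 1) * (c * rpow_gap \<rho> a t powr (\<alpha> - 1) * F t) \<le> t powr (\<rho> - 1) * x t"
    proof (rule pointwise_ge_of_integral_increments[where a = a and t = t
          and v = "\<lambda>t. t powr (\<rho> - 1) * x t"
          and G = "\<lambda>t. t powr (\<rho> - 1) * (c * rpow_gap \<rho> a t powr (\<alpha> - 1) * F t)"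
          and u = "\<lambda>s. s powr (\<rho> - 1) * katugampola_integral \<rho> a \<gamma> f s"])
      show "continuous_on {a<..} (\<lambda>t. t powr (\<rho> - 1) * x t)"
        using gap_pos(2) by (intro continuous_intros R(3)) auto
      show "continuous_on {a<..} (\<lambda>t. t powr (\<rho> - 1) * (c * rpow_gap \<rho> a t powr (\<alpha> - 1) * F t))"
        using gap_pos(2,3) assms by (intro continuous_intros F_cont) auto
      show "set_integrable lborel {a<..<s} (\<lambda>s. s powr (\<rho> - 1) * x s)" if "a < s" for s
        using R(4)[OF that] assms by (simp add: katugampola_integral_exists_one)
      show "set_integrable lborel {a<..<s} (\<lambda>s. s powr (\<rho> - 1) * katugampola_integral \<rho> a \<gamma> f s)" if "a < s" for s
        using katugampola_integral_semigroup(1)[of \<rho> a s 1 \<gamma> f] R(2)[of "1 + \<gamma>" s] assms \<gamma> that f_meas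
        by (simp add: katugampola_integral_exists_one)
      show "s powr (\<rho> - 1) * (c * rpow_gap \<rho> a s powr (\<alpha> - 1) * F s)
          \<le> s powr (\<rho> - 1) * katugampola_integral \<rho> a \<gamma> f s" if "a < s" for s
        using I_ge[OF that] by (rule mult_left_mono) simp
      fix r s assume rs: "a < r" "r < s"
      define K where "K = xa * (Beta \<gamma> 1 / Gamma \<gamma>)"
      have "K \<ge> 0"
        using \<gamma> assms Gamma_real_pos[of \<gamma>] Gamma_real_pos[of "\<gamma> + 1"] by (simp add: K_def Beta_def)
      have "rpow_gap \<rho> a r powr \<gamma> \<le> rpow_gap \<rho> a s powr \<gamma>"
        using rs gap_pos(1)[OF rs(1)] assms \<gamma>
        by (intro powr_mono2 divide_right_mono diff_right_mono) auto
      then have "K * rpow_gap \<rho> a r powr \<gamma> \<le> K * rpow_gap \<rho> a s powr \<gamma>"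
        using \<open>K \<ge> 0\<close> by (rule mult_left_mono)
      then show "(LINT q:{a<..<s}|lborel. q powr (\<rho> - 1) * katugampola_integral \<rho> a \<gamma> f q)
          - (LINT q:{a<..<r}|lborel. q powr (\<rho> - 1) * katugampola_integral \<rho> a \<gamma> f q)
        \<le> (LINT q:{a<..<s}|lborel. q powr (\<rho> - 1) * x q) - (LINT q:{a<..<r}|lborel. q powr (\<rho> - 1) * x q)"
        using R(5)[of r] R(5)[of s] rs assms
        unfolding K_def[symmetric] by (simp add: katugampola_integral_one)
    qed (use that in auto)
    then show ?thesis using gap_pos(2)[OF that] by simp
  qed
  \<comment> \<open>Nontriviality of \<open>x\<close> is used here: \<open>F\<close> increases
    strictly just after \<open>t1\<close>, hence is positive at \<open>t0\<close> and, being
    monotone, ever after.\<close>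
  have "0 < w t1" using t1 gap_pos[OF t1(1)] assms(2) by (simp add: w_def h_def)
  then obtain d where d: "0 < d" "\<And>e. 0 < e \<Longrightarrow> e < d \<Longrightarrow> F t1 < F (t1 + e)"
    using has_real_derivative_pos_inc_right[OF has_field_derivative_at_within[OF F_der[OF t1(1)]], of UNIV] by auto
  define t0 where "t0 = t1 + d / 2"
  have t0: "a < t0" "0 < F t0"
    using d(1) d(2)[of "d / 2"] F_nonneg[of t1] t1 by (auto simp: t0_def)
  show False
  \<comment> \<open>Raising \<open>x_ge\<close> to the power \<open>m\<close> produces
    \<open>c powr m\<close> and the exponent \<open>(\<alpha> - 1) * m\<close>; the weight in
    \<open>h\<close> contributes \<open>\<mu>\<close>.\<close>
  proof (rule power_differential_inequality_blow_up[where \<rho> = \<rho> and a = a and ?t0.0 = t0 and m = m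
        and k = "c powr m" and \<theta> = "\<mu> + (\<alpha> - 1) * m" and F = F and w = w])
    show "0 < F t" if "t0 \<le> t" for t
      using F_mono[OF t0(1) that] t0(2) by linarith
    show "(F has_real_derivative w t) (at t)" if "t0 \<le> t" for t
      using F_der that t0 by simp
    show "0 < c powr m" using c by simp
    have "m * (1 - \<alpha>) < 1 + \<mu>" using assms by (simp add: field_simps)
    then show "-1 < \<mu> + (\<alpha> - 1) * m" by (simp add: algebra_simps)
    fix t assume t: "t0 \<le> t"
    then have "a < t" using t0 by simp
    have "(c * rpow_gap \<rho> a t powr (\<alpha> - 1) * F t) powr m \<le> \<bar>x t\<bar> powr m"
      using x_ge[OF \<open>a < t\<close>] c F_nonneg[of t] assms by (intro powr_mono2) auto
    moreover have "(c * rpow_gap \<rho> a t powr (\<alpha> - 1) * F t) powr m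
        = c powr m * rpow_gap \<rho> a t powr ((\<alpha> - 1) * m) * F t powr m"
      using c F_nonneg[of t] by (simp only: powr_mult powr_powr)
    ultimately have "t powr (\<rho> - 1) * (rpow_gap \<rho> a t powr \<mu> *
        (c powr m * rpow_gap \<rho> a t powr ((\<alpha> - 1) * m) * F t powr m)) \<le> w t"
      unfolding w_def h_def by (intro mult_left_mono) auto
    then show "c powr m * t powr (\<rho> - 1) * rpow_gap \<rho> a t powr (\<mu> + (\<alpha> - 1) * m) * F t powr m \<le> w t"
      by (simp only: powr_add mult_ac)
  qed (use assms t0 in auto)
qed

end
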